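(* Let $n\ge 1$ be an integer and let $\Phi_n(x)$ denote the $n$-th cyclotomic polynomial. Then for every $j=1,\dots,\phi(n)$ we have $\Phi_n^{(j)}(1)>0$. Consequently, for every $k=0,1,\dots,\phi(n)-1$, the function $x\mapsto \Phi_n^{(k)}(x)$ is strictly increasing on $[1,\infty)$.
   Context: $\Phi_n(x)=\prod_{0<d\le n,\ (d,n)=1}\bigl(x-e^{2\pi i d/n}\bigr)\in\mathbb{Z}[x]$ is the $n$-th cyclotomic polynomial, of degree $\phi(n)$ where $\phi$ is Euler's totient function; $\Phi_n^{(j)}$ denotes its $j$-th derivative. *)

theory Defs
  imports
    Complex_Main
    "HOL-Number_Theory.Totient"
    "HOL-Computational_Algebra.Polynomial"
begin

definition cyclotomic_prod :: "nat \<Rightarrow> complex poly" where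
  "cyclotomic_prod n =
     (\<Prod>d | 0 < d \<and> d \<le> n \<and> coprime d n. [:- exp (2 * of_real pi * \<i> * of_nat d / of_nat n), 1:])"

text \<open>
  The product above has integer coefficients; \<open>cyclotomic n\<close> is the same polynomial seen as an
  element of \<open>\<int>[x]\<close>. The description is well-defined: see \<open>of_int_cyclotomic\<close> below.
\<close>
definition cyclotomic :: "nat \<Rightarrow> int poly" where
  "cyclotomic n = (THE p. map_poly of_int p = cyclotomic_prod n)"

lemma map_poly_of_int_mult:
  "map_poly of_int (p * q) = (map_poly of_int p * map_poly of_int q :: 'a::comm_ring_1 poly)"
  by (rule poly_eqI) (simp add: coeff_map_poly coeff_mult)

lemma map_poly_of_int_add:
  "map_poly of_int (p + q) = (map_poly of_int p + map_poly of_int q :: 'a::comm_ring_1 poly)"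
  by (rule poly_eqI) (simp add: coeff_map_poly)

lemma map_poly_of_int_diff:
  "map_poly of_int (p - q) = (map_poly of_int p - map_poly of_int q :: 'a::comm_ring_1 poly)"
  by (rule poly_eqI) (simp add: coeff_map_poly)

lemma map_poly_of_int_prod:
  "map_poly of_int (prod f A) = (\<Prod>x\<in>A. map_poly of_int (f x) :: 'a::comm_ring_1 poly)"
  by (induction A rule: infinite_finite_induct) (simp_all add: map_poly_of_int_mult)

lemma map_poly_of_int_inj:
  assumes "map_poly of_int p = (map_poly of_int q :: 'a::ring_char_0 poly)"
  shows "p = q"
proof (rule poly_eqI)
  fix i
  have "(of_int (coeff p i) :: 'a) = of_int (coeff q i)"
    using arg_cong[OF assms, of "\<lambda>r. coeff r i"] by (simp add: coeff_map_poly)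
  then show "coeff p i = coeff q i"
    by simp
qed

lemma cyclotomic_prod_altdef:
  "cyclotomic_prod n = (\<Prod>d\<in>totatives n. [:- cis (2 * pi * real d / real n), 1:])"
  unfolding cyclotomic_prod_def
  by (rule prod.cong) (auto simp: in_totatives_iff cis_conv_exp mult_ac)

lemma lead_coeff_cyclotomic_prod: "lead_coeff (cyclotomic_prod n) = 1"
  by (simp add: cyclotomic_prod_altdef lead_coeff_prod)

lemma degree_cyclotomic_prod: "degree (cyclotomic_prod n) = totient n"
  by (simp add: cyclotomic_prod_altdef degree_prod_sum_eq totient_def)

lemma prod_roots_unity:
  assumes "n > 0"
  shows "(\<Prod>k\<in>{0<..n}. [:- cis (2 * pi * real k / real n), 1:]) = monom 1 n - 1"
proof -
  let ?f = "\<lambda>k. cis (2 * pi * real k / real n)"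
  let ?P = "\<Prod>k<n. [:- ?f k, 1:]"
  have "{0<..n} = insert n {0<..<n}" "{..<n} = insert 0 {0<..<n}"
    using assms by auto
  then have "(\<Prod>k\<in>{0<..n}. [:- ?f k, 1:]) = ?P"
    using assms by simp
  also have "?P = monom 1 n - 1"
  proof (rule poly_eqI_degree_lead_coeff[where n = n and A = "{z. z ^ n = 1}"])
    have deg: "degree ?P = n"
      by (subst degree_prod_sum_eq) auto
    have "lead_coeff ?P = 1"
      by (simp add: lead_coeff_prod)
    then show "coeff ?P n = coeff (monom 1 n - 1) n"
      using deg assms by simp
    show "degree ?P \<le> n"
      using deg by simp
    show "degree (monom 1 n - 1 :: complex poly) \<le> n"
      by (rule degree_diff_le) (auto simp: degree_monom_eq)
    show "n \<le> card {z::complex. z ^ n = 1}"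
      using card_roots_unity_eq[OF assms] by simp
    fix z :: complex assume z: "z \<in> {z. z ^ n = 1}"
    then obtain k where "k < n" "z = ?f k"
      using bij_betw_roots_unity[OF assms] by (auto simp: bij_betw_def)
    then have "poly ?P z = 0"
      by (auto simp: poly_prod)
    with z show "poly ?P z = poly (monom 1 n - 1) z"
      by (simp add: poly_monom)
  qed
  finally show ?thesis .
qed

lemma prod_cyclotomic_prod:
  assumes "n > 0"
  shows "(\<Prod>d | d dvd n. cyclotomic_prod d) = monom 1 n - 1"
proof -
  let ?l = "\<lambda>k. [:- cis (2 * pi * real k / real n), 1:]"
  have *: "cyclotomic_prod (n div d) = (\<Prod>k | k \<in> {0<..n} \<and> gcd k n = d. ?l k)" if dn: "d dvd n" for d
  proof -
    obtain m where m: "n = d * m"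
      using dn by auto
    have "(\<Prod>k | k \<in> {0<..n} \<and> gcd k n = d. ?l k) = (\<Prod>k\<in>totatives (n div d). ?l (k * d))"
      by (rule prod.reindex_bij_betw[symmetric, OF bij_betw_totatives_gcd_eq[OF dn assms]])
    also have "\<dots> = cyclotomic_prod (n div d)"
      unfolding cyclotomic_prod_altdef using assms m by (intro prod.cong) (auto simp: mult.assoc)
    finally show ?thesis ..
  qed
  have "(\<Prod>d | d dvd n. cyclotomic_prod d) = (\<Prod>d | d dvd n. cyclotomic_prod (n div d))"
    by (rule prod.reindex_bij_witness[of _ "\<lambda>d. n div d" "\<lambda>d. n div d"])
       (use assms in \<open>auto simp: div_dvd_iff_mult\<close>)
  also have "\<dots> = (\<Prod>d | d dvd n. \<Prod>k | k \<in> {0<..n} \<and> gcd k n = d. ?l k)"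
    by (intro prod.cong) (auto simp: *)
  also have "\<dots> = (\<Prod>k\<in>{0<..n}. ?l k)"
    by (rule prod.group) (use assms in auto)
  finally show ?thesis
    using prod_roots_unity[OF assms] by simp
qed

lemma cyclotomic_prod_integral: "\<exists>p. map_poly of_int p = cyclotomic_prod n"
proof (induction n rule: less_induct)
  case (less n)
  show ?case
  proof (cases "n = 0")
    case True
    then show ?thesis
      by (intro exI[of _ 1]) (simp add: cyclotomic_prod_altdef)
  next
    case False
    define D where "D = {d. d dvd n \<and> d \<noteq> n}"
    have D: "d < n" if "d \<in> D" for d
      using that False by (auto simp: D_def dest: dvd_imp_le)
    from less D have "\<forall>d\<in>D. \<exists>p. map_poly of_int p = cyclotomic_prod d"
      by blast
    then obtain f where f: "\<And>d. d \<in> D \<Longrightarrow> map_poly of_int (f d) = cyclotomic_prod d"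
      by metis
    define a where "a = prod f D"
    let ?h = "map_poly of_int :: int poly \<Rightarrow> complex poly"
    have a: "?h a = prod cyclotomic_prod D"
      unfolding a_def map_poly_of_int_prod by (intro prod.cong) (auto simp: f)
    have deg: "degree (?h p) = degree p" for p
      by (rule degree_map_poly) simp
    have "lead_coeff (?h a) = 1"
      unfolding a by (simp add: lead_coeff_prod lead_coeff_cyclotomic_prod)
    then have lca: "lead_coeff a = 1"
      by (simp add: deg coeff_map_poly)
    have a0: "a \<noteq> 0"
      using lca by auto
    have fin: "finite D"
      using D by (auto intro!: finite_subset[of D "{..<n}"])
    have "{d. d dvd n} = insert n D"
      by (auto simp: D_def)
    then have "(\<Prod>d | d dvd n. cyclotomic_prod d) = cyclotomic_prod n * ?h a"
      using fin by (simp add: a D_def)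
    then have eq: "cyclotomic_prod n * ?h a = monom 1 n - 1"
      using prod_cyclotomic_prod[of n] False by simp
    obtain q r where qr: "pseudo_divmod (monom 1 n - 1) a = (q, r)"
      by force
    from pseudo_divmod[OF a0 qr] have div: "monom 1 n - 1 = a * q + r"
      and r: "r = 0 \<or> degree r < degree a"
      by (simp_all add: lca)
    have "?h (monom 1 n - 1) = monom 1 n - 1"
      by (simp add: map_poly_of_int_diff map_poly_monom)
    then have "monom 1 n - 1 = ?h a * ?h q + ?h r"
      by (simp add: div map_poly_of_int_add map_poly_of_int_mult)
    then have hr: "?h a * (cyclotomic_prod n - ?h q) = ?h r"
      using eq by (simp add: algebra_simps)
    have ha0: "?h a \<noteq> 0"
      using \<open>lead_coeff (?h a) = 1\<close> by auto
    have "cyclotomic_prod n - ?h q = 0"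
    proof (rule ccontr)
      assume ne: "cyclotomic_prod n - ?h q \<noteq> 0"
      then have "?h r \<noteq> 0"
        using ha0 hr by (metis mult_eq_0_iff)
      moreover have "degree (?h r) \<ge> degree (?h a)"
        unfolding hr[symmetric] using ne ha0 by (simp add: degree_mult_eq)
      ultimately show False
        using r by (auto simp: deg)
    qed
    then show ?thesis
      by (intro exI[of _ q]) simp
  qed
qed

lemma of_int_cyclotomic: "map_poly of_int (cyclotomic n) = cyclotomic_prod n"
proof -
  obtain p where p: "map_poly of_int p = cyclotomic_prod n"
    using cyclotomic_prod_integral by blast
  show ?thesis
    unfolding cyclotomic_def
    by (rule theI[of _ p]) (use p in \<open>auto intro: map_poly_of_int_inj[where 'a = complex]\<close>)
qed

lemma degree_cyclotomic: "degree (cyclotomic n) = totient n"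
  by (metis degree_cyclotomic_prod of_int_cyclotomic degree_map_poly of_int_eq_0_iff)

end

theory Submission
  imports Defs
begin

text \<open>
  For \<open>n \<ge> 3\<close> the roots of \<open>\<Phi>\<^sub>n\<close> come in conjugate pairs \<open>cis (\<plusminus>t)\<close> with \<open>cos t < 1\<close>, so
  \<open>\<Phi>\<^sub>n(1 + x)\<close> is a product of factors \<open>x\<^sup>2 + 2 (1 - cos t) x + 2 (1 - cos t)\<close>, whose coefficients
  are all positive. Hence every coefficient of \<open>\<Phi>\<^sub>n(1 + x)\<close> up to the degree is positive, and these
  are the numbers \<open>\<Phi>\<^sub>n\<^sup>(\<^sup>j\<^sup>)(1) / j!\<close>.
\<close>

text \<open>Gaps below the degree are excluded because mere nonnegativity would not keep every
  coefficient of a product positive.\<close>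

definition pos_coeffs :: "real poly \<Rightarrow> bool" where
  "pos_coeffs p \<longleftrightarrow> (\<forall>i\<le>degree p. coeff p i > 0)"

lemma pos_coeffs_nonneg: "pos_coeffs p \<Longrightarrow> coeff p i \<ge> 0"
  by (cases "i \<le> degree p") (auto simp: pos_coeffs_def coeff_eq_0 intro: less_imp_le)

lemma pos_coeffs_one: "pos_coeffs 1"
  by (simp add: pos_coeffs_def)

lemma pos_coeffs_mult:
  assumes "pos_coeffs p" "pos_coeffs q"
  shows "pos_coeffs (p * q)"
  unfolding pos_coeffs_def
proof (intro allI impI)
  fix k assume "k \<le> degree (p * q)"
  then have k: "k \<le> degree p + degree q"
    using degree_mult_le[of p q] by linarith
  \<comment> \<open>All terms of the convolution are nonnegative, so one positive term suffices.
    This index is at most \<open>degree p\<close>, and \<open>k - ?i\<close> is either 0 or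
    \<open>k - degree p\<close>, hence at most \<open>degree q\<close>.\<close>
  let ?i = "min k (degree p)"
  show "coeff (p * q) k > 0"
    unfolding coeff_mult
  proof (rule sum_pos2[of _ ?i])
    show "0 < coeff p ?i * coeff q (k - ?i)"
      using assms k unfolding pos_coeffs_def by (intro mult_pos_pos) auto
  qed (use assms in \<open>auto intro: mult_nonneg_nonneg pos_coeffs_nonneg\<close>)
qed

lemma pos_coeffs_prod: "(\<And>x. x \<in> A \<Longrightarrow> pos_coeffs (f x)) \<Longrightarrow> pos_coeffs (prod f A)"
  by (induction A rule: infinite_finite_induct) (auto intro: pos_coeffs_mult pos_coeffs_one)

text \<open>The inner function has derivative 1, so the chain rule contributes no factor.\<close>

lemma higher_pderiv_pcompose_shift:
  fixes p :: "'a::idom poly"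
  shows "(pderiv ^^ j) (pcompose p [:a, 1:]) = pcompose ((pderiv ^^ j) p) [:a, 1:]"
  by (induction j) (simp_all add: pderiv_pcompose pderiv_pCons)

lemma map_poly_of_real_mult:
  "map_poly of_real (p * q) = (map_poly of_real p * map_poly of_real q :: complex poly)"
  by (rule poly_eqI) (simp add: coeff_map_poly coeff_mult)

lemma map_poly_of_real_prod:
  "map_poly of_real (prod f A) = (\<Prod>x\<in>A. map_poly of_real (f x) :: complex poly)"
  by (induction A rule: infinite_finite_induct) (simp_all add: map_poly_of_real_mult)

text \<open>Real factorizations can thus be checked over the complex numbers, where the linear
  factors live; \<open>of_real\<close> is injective on coefficients.\<close>

lemma real_cyclotomic_eqI:
  assumes "map_poly of_real r = cyclotomic_prod n"
  shows "map_poly real_of_int (cyclotomic n) = r"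
proof (rule poly_eqI)
  fix i
  have "complex_of_real (coeff r i) = of_int (coeff (cyclotomic n) i)"
    using arg_cong[OF trans[OF assms of_int_cyclotomic[symmetric]], of "\<lambda>p. coeff p i"]
    by (simp add: coeff_map_poly)
  then have "complex_of_real (coeff r i) = complex_of_real (of_int (coeff (cyclotomic n) i))"
    by simp
  then show "coeff (map_poly real_of_int (cyclotomic n)) i = coeff r i"
    by (simp add: coeff_map_poly del: of_real_of_int_eq)
qed

lemma real_cyclotomic_1: "map_poly real_of_int (cyclotomic 1) = [:-1, 1:]"
  by (rule real_cyclotomic_eqI) (simp add: cyclotomic_prod_altdef map_poly_pCons)

lemma totatives_2: "totatives 2 = {1}"
  by (auto simp: in_totatives_iff le_Suc_eq numeral_2_eq_2)

lemma real_cyclotomic_2: "map_poly real_of_int (cyclotomic 2) = [:1, 1:]"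
  by (rule real_cyclotomic_eqI) (simp add: cyclotomic_prod_altdef totatives_2 map_poly_pCons)

text \<open>The totatives \<open>d\<close> and \<open>n - d\<close> index conjugate roots, and
  \<open>2 * d < n\<close> selects one from each pair.\<close>

lemma real_cyclotomic_altdef:
  assumes "n \<ge> 3"
  shows "map_poly real_of_int (cyclotomic n) =
           (\<Prod>d | d \<in> totatives n \<and> 2 * d < n. [:1, -2 * cos (2 * pi * real d / real n), 1:])"
proof (rule real_cyclotomic_eqI)
  let ?l = "\<lambda>d. [:- cis (2 * pi * real d / real n), 1:]"
  let ?A = "{d. d \<in> totatives n \<and> 2 * d < n}" and ?B = "{d. d \<in> totatives n \<and> n < 2 * d}"
  \<comment> \<open>No totative is its own partner: \<open>2 * d = n\<close> makes \<open>d\<close>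
    a common divisor of \<open>d\<close> and \<open>n\<close>, so \<open>d = 1\<close> and
    \<open>n = 2\<close>.\<close>
  have "2 * d \<noteq> n" if "d \<in> totatives n" for d
  proof
    assume "2 * d = n"
    then have "gcd d n = d"
      by auto
    with that have "d = 1"
      by (auto simp: in_totatives_iff)
    with \<open>2 * d = n\<close> assms show False
      by simp
  qed
  then have split: "totatives n = ?A \<union> ?B"
    by (auto simp: neq_iff)
  have conj: "?l d * ?l (n - d) = map_poly of_real [:1, -2 * cos (2 * pi * real d / real n), 1:]"
    if "d \<in> ?A" for d
  proof -
    let ?t = "2 * pi * real d / real n"
    have "2 * pi * real (n - d) / real n = 2 * pi - ?t"
      using that assms by (simp add: of_nat_diff field_simps)
    then have eq: "cis (2 * pi * real (n - d) / real n) = cis (- ?t)"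
      by (simp add: cis.ctr)
    show ?thesis
      unfolding eq by (simp add: map_poly_pCons complex_eq_iff cis_mult)
  qed
  have "cyclotomic_prod n = prod ?l ?A * prod ?l ?B"
    unfolding cyclotomic_prod_altdef by (subst split, rule prod.union_disjoint) auto
  also have "prod ?l ?B = (\<Prod>d\<in>?A. ?l (n - d))"
  proof (rule prod.reindex_bij_witness[of _ "\<lambda>d. n - d" "\<lambda>d. n - d"])
    have mem: "n - d \<in> totatives n" if "d \<in> totatives n" for d
    proof -
      have "d < n"
        using that assms by (auto simp: in_totatives_iff order.order_iff_strict)
      with that show ?thesis
        by (auto simp: in_totatives_iff coprime_iff_gcd_eq_1 gcd_diff2_nat)
    qed
    show "n - d \<in> ?A" if "d \<in> ?B" for d
      using that mem assms by auto
    show "n - d \<in> ?B" if "d \<in> ?A" for d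
      using that mem by auto
  qed (auto simp: in_totatives_iff)
  also have "prod ?l ?A * (\<Prod>d\<in>?A. ?l (n - d)) = (\<Prod>d\<in>?A. ?l d * ?l (n - d))"
    by (simp only: prod.distrib)
  also have "\<dots> = (\<Prod>d\<in>?A. map_poly of_real [:1, -2 * cos (2 * pi * real d / real n), 1:])"
    by (rule prod.cong[OF refl conj])
  finally show "map_poly of_real (\<Prod>d\<in>?A. [:1, -2 * cos (2 * pi * real d / real n), 1:])
                  = cyclotomic_prod n"
    by (simp only: map_poly_of_real_prod)
qed

text \<open>For \<open>n = 2\<close> the only root is -1, its own conjugate, so this case is
  computed directly as x + 2.\<close>

lemma pos_coeffs_cyclotomic_shift:
  assumes "n \<ge> 2"
  shows "pos_coeffs (pcompose (map_poly real_of_int (cyclotomic n)) [:1, 1:])"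
proof (cases "n = 2")
  case True
  then show ?thesis
    by (simp add: real_cyclotomic_2 pcompose_pCons pos_coeffs_def le_Suc_eq)
next
  case False
  with assms have n: "n \<ge> 3"
    by simp
  show ?thesis
    unfolding real_cyclotomic_altdef[OF n] pcompose_prod
  proof (rule pos_coeffs_prod)
    fix d assume "d \<in> {d. d \<in> totatives n \<and> 2 * d < n}"
    then have d: "0 < d" "2 * d < n"
      by (auto simp: in_totatives_iff)
    let ?t = "2 * pi * real d / real n"
    have "real (2 * d) < real n"
      using d by (simp only: of_nat_less_iff)
    \<comment> \<open>On this interval the cosine lies strictly below its value at 0.\<close>
    then have "0 < ?t" "?t < pi"
      using d by (auto simp: field_simps)
    then have "cos ?t < 1"
      using cos_monotone_0_pi[of 0 ?t] by simp
    then show "pos_coeffs (pcompose [:1, -2 * cos ?t, 1:] [:1, 1:])"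
      by (auto simp: pcompose_pCons pos_coeffs_def le_Suc_eq numeral_2_eq_2)
  qed
qed

text \<open>For \<open>n = 1\<close> the shifted polynomial is x, with constant coefficient 0; hence
  strict positivity is claimed only from index 1 on.\<close>

lemma coeff_cyclotomic_shift:
  assumes "n \<ge> 1"
  defines "q \<equiv> pcompose (map_poly real_of_int (cyclotomic n)) [:1, 1:]"
  shows "coeff q i \<ge> 0" and "i \<in> {1..totient n} \<Longrightarrow> coeff q i > 0"
proof -
  have deg: "degree q = totient n"
    by (simp add: q_def degree_pcompose degree_map_poly degree_cyclotomic)
  have "coeff q i \<ge> 0 \<and> (i \<in> {1..totient n} \<longrightarrow> coeff q i > 0)"
  proof (cases "n = 1")
    case True
    then have "q = [:0, 1:]"
      using real_cyclotomic_1 by (simp add: q_def pcompose_pCons)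
    then show ?thesis
      using True by (auto simp: coeff_pCons split: nat.splits)
  next
    case False
    with assms have "pos_coeffs q"
      using pos_coeffs_cyclotomic_shift by simp
    then show ?thesis
      using deg pos_coeffs_nonneg by (auto simp: pos_coeffs_def)
  qed
  then show "coeff q i \<ge> 0" and "i \<in> {1..totient n} \<Longrightarrow> coeff q i > 0"
    by auto
qed

lemma poly_ge_coeff_0:
  fixes p :: "real poly"
  assumes "\<And>i. coeff p i \<ge> 0" "x \<ge> 0"
  shows "poly p x \<ge> coeff p 0"
  using assms(1)
proof (induction p)
  case (pCons a p)
  have nonneg: "coeff p i \<ge> 0" for i
    using pCons.prems[of "Suc i"] by simp
  then have "poly p x \<ge> 0"
    using pCons.IH order_trans by blast
  then show ?case
    using assms(2) by simp
qed simp

text \<open>After the shift by 1, the j-th derivative has nonnegative coefficients and constant term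
  j! times the positive coefficient of index j, which bounds its values from below at
  \<open>x - 1\<close>.\<close>

lemma higher_pderiv_cyclotomic_pos:
  assumes "n \<ge> 1" "j \<in> {1..totient n}" "x \<ge> 1"
  shows "poly ((pderiv ^^ j) (map_poly real_of_int (cyclotomic n))) x > 0"
proof -
  let ?p = "map_poly real_of_int (cyclotomic n)"
  let ?q = "pcompose ?p [:1, 1:]"
  have "0 < coeff ((pderiv ^^ j) ?q) 0"
    using coeff_cyclotomic_shift(2)[OF assms(1,2)]
    by (simp add: coeff_higher_pderiv pochhammer_fact[symmetric])
  also have "\<dots> \<le> poly ((pderiv ^^ j) ?q) (x - 1)"
    using coeff_cyclotomic_shift(1)[OF assms(1)] assms(3)
    by (intro poly_ge_coeff_0)
       (auto simp: coeff_higher_pderiv pochhammer_nonneg intro!: mult_nonneg_nonneg)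
  also have "\<dots> = poly ((pderiv ^^ j) ?p) x"
    by (simp add: higher_pderiv_pcompose_shift poly_pcompose)
  finally show ?thesis .
qed

theorem theorem1p1:
  fixes n :: nat
  assumes "n \<ge> 1"
  shows "(\<forall>j\<in>{1..totient n}. poly ((pderiv ^^ j) (map_poly real_of_int (cyclotomic n))) 1 > 0) \<and>
         (\<forall>k\<in>{0..<totient n}.
            strict_mono_on {1..} (\<lambda>x::real. poly ((pderiv ^^ k) (map_poly real_of_int (cyclotomic n))) x))"
proof (intro conjI ballI)
  fix j assume "j \<in> {1..totient n}"
  then show "poly ((pderiv ^^ j) (map_poly real_of_int (cyclotomic n))) 1 > 0"
    using higher_pderiv_cyclotomic_pos[OF assms] by simp
next
  fix k assume k: "k \<in> {0..<totient n}"
  let ?f = "(pderiv ^^ k) (map_poly real_of_int (cyclotomic n))"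
  show "strict_mono_on {1..} (\<lambda>x. poly ?f x)"
  proof (rule strict_mono_onI)
    fix x y :: real assume xy: "x \<in> {1..}" "x < y"
    show "poly ?f x < poly ?f y"
    proof (rule DERIV_pos_imp_increasing[OF xy(2)])
      fix z assume "x \<le> z"
      \<comment> \<open>The derivative of \<open>?f\<close> has order \<open>Suc k\<close>, which is
        at most \<open>totient n\<close> since \<open>k < totient n\<close>.\<close>
      then have "poly (pderiv ?f) z > 0"
        using higher_pderiv_cyclotomic_pos[OF assms, of "Suc k" z] k xy(1) by simp
      then show "\<exists>D. DERIV (poly ?f) z :> D \<and> 0 < D"
        using poly_DERIV by blast
    qed
  qed
qed

end
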